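(* Suppose Assumptions 1 and 2 (stated in the context) hold, $f$ is $L_f$-smooth and $c$ is $L_c$-smooth. Let $\lambda>G/\rho$ and $p=\frac{\lambda\rho}{\lambda\rho-G}$. Let $\epsilon>0$ be the target accuracy for which Assumption 2(iii) is assumed, and in the algorithm LoPNAG (described in the context) let $$\gamma_1=\frac{\epsilon_0}{6p\ln 2},\qquad K=\lceil\log_2(\epsilon_0/\epsilon)\rceil,\qquad t_k=\left\lceil\frac{\sigma}{\epsilon^{1-\theta}}\max\left\{\lambda G_c\,p\sqrt{18\ln 2},\ \sqrt{12\,(L_f+\lambda L_c)\,\epsilon_0/2^{k-1}}\right\}\right\rceil,\quad k=1,\dots,K,$$ where $\theta,\sigma$ are the constants appearing in the local error bound condition, Assumption 2(iii). Then the output $\mathbf{x}_K$ satisfies $$f(\mathbf{x}_K)-f_*\le 2\epsilon .$$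
   Context: The problem is $\min_{\mathbf{x}\in\mathbb{R}^d} f(\mathbf{x})$ subject to $c(\mathbf{x})\le 0$, with $f$ convex and $c$ lower-semicontinuous and convex; $\Omega_*$ is its set of optimal solutions and $f_*$ its optimal value. $\Omega=\{\mathbf{x}\in\mathbb{R}^d:c(\mathbf{x})\le 0\}$; $\|\cdot\|$ is the Euclidean norm; $\mathrm{dist}(\mathbf{x},S)=\min_{\mathbf{u}\in S}\|\mathbf{x}-\mathbf{u}\|$; $\Pi_\Omega[\mathbf{x}]=\arg\min_{\mathbf{u}\in\Omega}\|\mathbf{u}-\mathbf{x}\|^2$; $[s]_+=\max(s,0)$; $\mathcal{S}_\epsilon=\{\mathbf{x}\in\Omega:f(\mathbf{x})\le f_*+\epsilon\}$. A function is $L$-smooth if its gradient is $L$-Lipschitz. Assumption 1: (i) there exists $\rho>0$ such that $\min\{\|\mathbf{v}\|: c(\mathbf{x})=0,\ \mathbf{v}\in\partial c(\mathbf{x}),\ \mathbf{v}\ne 0\}\ge\rho$, or, more generally, there exists $\rho>0$ such that for every $\mathbf{x}\in\mathbb{R}^d$ the point $\mathbf{x}^\natural=\Pi_\Omega[\mathbf{x}]$ satisfies $\|\mathbf{x}^\natural-\mathbf{x}\|\le [c(\mathbf{x})]_+/\rho$ (the first condition implies the second with the same $\rho$); (ii) there exists $\mathbf{x}$ with $c(\mathbf{x})<0$; (iii) $f$ and $c$ are defined everywhere on $\mathbb{R}^d$ and are Lipschitz continuous with Lipschitz constants $G$ and $G_c$, respectively. Assumption 2: (i) there exist $\mathbf{x}_0\in\Omega$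 and $\epsilon_0\ge 0$ with $f(\mathbf{x}_0)-\min_{\mathbf{x}\in\Omega}f(\mathbf{x})\le\epsilon_0$; (ii) $\Omega_*$ is a non-empty convex compact set; (iii) (local error bound) there exist $\theta\in(0,1]$ and $\sigma>0$ such that $\mathrm{dist}(\mathbf{x},\Omega_* )\le\sigma(f(\mathbf{x})-f_* )^\theta$ for every $\mathbf{x}\in\mathcal{S}_\epsilon$. Algorithm LoPNAG. For $\gamma>0$ let $F_\gamma(\mathbf{x})=f(\mathbf{x})+\gamma\ln\bigl(1+\exp(\lambda c(\mathbf{x})/\gamma)\bigr)$, with smoothness parameter $L_{F_\gamma}=L_f+\lambda L_c+\frac{\lambda^2G_c^2}{4\gamma}$. Let $\tau_0=1$, $\tau_s=\frac{1+\sqrt{1+4\tau_{s-1}^2}}{2}$ and $\beta_s=\frac{\tau_{s-1}-1}{\tau_s}$ for $s\ge 1$. Input $K,t_1,\dots,t_K\in\mathbb{N}^+$ and $\gamma_1$; initialize with $\mathbf{x}_0,\epsilon_0$ of Assumption 2(i). For $k=1,\dots,K$: put $L_k=L_{F_{\gamma_k}}$ and $\mathbf{x}^k_0=\mathbf{y}^k_0=\mathbf{x}_{k-1}$; for $s=0,1,\dots,t_k-1$ set $\mathbf{x}^k_{s+1}=\mathbf{y}^k_s-\frac{1}{L_k}\nabla F_{\gamma_k}(\mathbf{y}^k_s)$ and $\mathbf{y}^k_{s+1}=\mathbf{x}^k_{s+1}+\beta_{s+1}(\mathbf{x}^k_{s+1}-\mathbf{x}^k_s)$; then set $\widehat{\mathbf{x}}_k=\mathbf{x}^k_{t_k}$,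 $\mathbf{x}_k=\Pi_\Omega[\widehat{\mathbf{x}}_k]$ and $\gamma_{k+1}=\gamma_k/2$. The output is $\mathbf{x}_K$; one projection is performed per epoch $k$. *)

theory Defs
  imports "HOL-Analysis.Analysis"
begin

(* Real-valued form: all strict superlevel sets are open. *)
definition lower_semicontinuous :: "('a::topological_space \<Rightarrow> real) \<Rightarrow> bool" where
  "lower_semicontinuous g \<longleftrightarrow> (\<forall>a. open {x. a < g x})"

definition subdifferential :: "('a::real_inner \<Rightarrow> real) \<Rightarrow> 'a \<Rightarrow> 'a set" where
  "subdifferential g x = {v. \<forall>y. g x + v \<bullet> (y - x) \<le> g y}"

(* Meaningful only where g is differentiable; the gradient is then unique. *)
definition gradient :: "('a::real_inner \<Rightarrow> real) \<Rightarrow> 'a \<Rightarrow> 'a" where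
  "gradient g x = (THE v. GDERIV g x :> v)"

definition smooth :: "real \<Rightarrow> ('a::real_inner \<Rightarrow> real) \<Rightarrow> bool" where
  "smooth L g \<longleftrightarrow> (\<forall>x. g differentiable at x) \<and> L-lipschitz_on UNIV (gradient g)"

definition feasible :: "('a \<Rightarrow> real) \<Rightarrow> 'a set" where
  "feasible c = {x. c x \<le> 0}"

definition opt_set :: "('a \<Rightarrow> real) \<Rightarrow> ('a \<Rightarrow> real) \<Rightarrow> 'a set" where
  "opt_set f c = {x \<in> feasible c. \<forall>y \<in> feasible c. f x \<le> f y}"

(* The infimum is the minimum of f over the feasible set whenever opt_set f c is nonempty. *)
definition opt_val :: "('a \<Rightarrow> real) \<Rightarrow> ('a \<Rightarrow> real) \<Rightarrow> real" where
  "opt_val f c = (INF x \<in> feasible c. f x)"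

definition sublevel :: "('a \<Rightarrow> real) \<Rightarrow> ('a \<Rightarrow> real) \<Rightarrow> real \<Rightarrow> 'a set" where
  "sublevel f c \<epsilon> = {x \<in> feasible c. f x \<le> opt_val f c + \<epsilon>}"

(* A lower bound on nonzero subgradients at the boundary, or a global error bound for the
   constraint. The minimum of norms in the former is rendered as a lower bound on each norm. *)
definition regularity ::
    "('a::{real_inner,heine_borel} \<Rightarrow> real) \<Rightarrow> real \<Rightarrow> bool" where
  "regularity c \<rho> \<longleftrightarrow>
     (\<forall>x v. c x = 0 \<and> v \<in> subdifferential c x \<and> v \<noteq> 0 \<longrightarrow> \<rho> \<le> norm v) \<or>
     (\<forall>x. norm (closest_point (feasible c) x - x) \<le> max (c x) 0 / \<rho>)"

definition local_error_bound ::
    "('a::metric_space \<Rightarrow> real) \<Rightarrow> ('a \<Rightarrow> real) \<Rightarrow> real \<Rightarrow> real \<Rightarrow> real \<Rightarrow> bool" where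
  "local_error_bound f c \<epsilon> \<theta> \<sigma> \<longleftrightarrow>
     (\<forall>x \<in> sublevel f c \<epsilon>. infdist x (opt_set f c) \<le> \<sigma> * (f x - opt_val f c) powr \<theta>)"

definition penalized :: "('a \<Rightarrow> real) \<Rightarrow> ('a \<Rightarrow> real) \<Rightarrow> real \<Rightarrow> real \<Rightarrow> 'a \<Rightarrow> real" where
  "penalized f c lam \<gamma> x = f x + \<gamma> * ln (1 + exp (lam * c x / \<gamma>))"

definition penalized_smoothness :: "real \<Rightarrow> real \<Rightarrow> real \<Rightarrow> real \<Rightarrow> real \<Rightarrow> real" where
  "penalized_smoothness L\<^sub>f L\<^sub>c G\<^sub>c lam \<gamma> = L\<^sub>f + lam * L\<^sub>c + lam\<^sup>2 * G\<^sub>c\<^sup>2 / (4 * \<gamma>)"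

primrec \<tau> :: "nat \<Rightarrow> real" where
  "\<tau> 0 = 1"
| "\<tau> (Suc s) = (1 + sqrt (1 + 4 * (\<tau> s)\<^sup>2)) / 2"

(* Only used for s \<ge> 1. *)
definition \<beta> :: "nat \<Rightarrow> real" where
  "\<beta> s = (\<tau> (s - 1) - 1) / \<tau> s"

(* The pair (x_s, y_s) of one epoch that minimizes F with step size 1/L, started at z. *)
primrec nag :: "('a::real_inner \<Rightarrow> real) \<Rightarrow> real \<Rightarrow> 'a \<Rightarrow> nat \<Rightarrow> 'a \<times> 'a" where
  "nag F L z 0 = (z, z)"
| "nag F L z (Suc s) =
     (let (x, y) = nag F L z s;
          x' = y - (1 / L) *\<^sub>R gradient F y
      in (x', x' + \<beta> (Suc s) *\<^sub>R (x' - x)))"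

(* The pair (x_k, \<gamma>_(k+1)) after k epochs; t k is the number of inner steps of epoch k. *)
primrec lopnag_state ::
    "('a::{real_inner,heine_borel} \<Rightarrow> real) \<Rightarrow> ('a \<Rightarrow> real) \<Rightarrow> real \<Rightarrow> real \<Rightarrow> real \<Rightarrow> real \<Rightarrow>
     (nat \<Rightarrow> nat) \<Rightarrow> real \<Rightarrow> 'a \<Rightarrow> nat \<Rightarrow> 'a \<times> real" where
  "lopnag_state f c L\<^sub>f L\<^sub>c G\<^sub>c lam t \<gamma>\<^sub>1 x\<^sub>0 0 = (x\<^sub>0, \<gamma>\<^sub>1)"
| "lopnag_state f c L\<^sub>f L\<^sub>c G\<^sub>c lam t \<gamma>\<^sub>1 x\<^sub>0 (Suc k) =
     (let (x, \<gamma>) = lopnag_state f c L\<^sub>f L\<^sub>c G\<^sub>c lam t \<gamma>\<^sub>1 x\<^sub>0 k;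
          xhat = fst (nag (penalized f c lam \<gamma>)
                          (penalized_smoothness L\<^sub>f L\<^sub>c G\<^sub>c lam \<gamma>) x (t (Suc k)))
      in (closest_point (feasible c) xhat, \<gamma> / 2))"

definition lopnag ::
    "('a::{real_inner,heine_borel} \<Rightarrow> real) \<Rightarrow> ('a \<Rightarrow> real) \<Rightarrow> real \<Rightarrow> real \<Rightarrow> real \<Rightarrow> real \<Rightarrow>
     (nat \<Rightarrow> nat) \<Rightarrow> real \<Rightarrow> 'a \<Rightarrow> nat \<Rightarrow> 'a" where
  "lopnag f c L\<^sub>f L\<^sub>c G\<^sub>c lam t \<gamma>\<^sub>1 x\<^sub>0 K = fst (lopnag_state f c L\<^sub>f L\<^sub>c G\<^sub>c lam t \<gamma>\<^sub>1 x\<^sub>0 K)"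

end

theory Submission
  imports Defs
begin

text \<open>The invariant is that epoch \<open>k\<close> ends at a feasible point with gap at most
  \<open>\<epsilon> + \<epsilon>\<^sub>0 / 2\<^bsup>k\<^esup>\<close>. One compares with the projection \<open>u\<close> of the starting point of the epoch onto
  the \<open>\<epsilon>\<close>-sublevel set, not with an optimal point: convexity and the local error bound give
  that \<open>u\<close> has distance at most \<open>\<sigma> \<epsilon>\<^bsup>\<theta>-1\<^esup>\<close> times \<open>\<epsilon>\<^sub>0 / 2\<^bsup>k-1\<^esup>\<close>. The accelerated rate then makes
  \<open>F\<^sub>\<gamma>(xhat) - F\<^sub>\<gamma>(u)\<close> small, and since \<open>\<lambda>\<rho> \<ge> G\<close>, projecting onto the feasible set costs no
  more in \<open>f\<close> than the penalty at \<open>xhat\<close>.\<close>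

section \<open>Gradients of smooth and convex functions\<close>

lemma GDERIV_unique:
  assumes "GDERIV g x :> u" "GDERIV g x :> v"
  shows "u = v"
proof -
  have "(\<lambda>h. h \<bullet> u) = (\<lambda>h. h \<bullet> v)"
    using assms has_derivative_unique unfolding gderiv_def by blast
  then have "(u - v) \<bullet> u = (u - v) \<bullet> v"
    by (rule fun_cong)
  then have "(u - v) \<bullet> (u - v) = 0"
    by (simp add: inner_diff_right)
  then show ?thesis
    by simp
qed

lemma gradient_eqI:
  "GDERIV g x :> v \<Longrightarrow> gradient g x = v"
  unfolding gradient_def by (blast intro: the_equality GDERIV_unique)

lemma GDERIV_gradient:
  fixes g :: "'a::euclidean_space \<Rightarrow> real"
  assumes "g differentiable at x"
  shows "GDERIV g x :> gradient g x"
proof -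
  obtain g' where g': "(g has_derivative g') (at x)"
    using assms by (auto simp: differentiable_def)
  \<comment> \<open>\<open>adjoint g' 1\<close> is the Riesz representer of the functional
    \<open>g'\<close>.\<close>
  have "g' = (\<lambda>h. h \<bullet> adjoint g' 1)"
    using adjoint_works[OF has_derivative_linear[OF g'], of _ 1] by (simp add: fun_eq_iff)
  with g' have "GDERIV g x :> adjoint g' 1"
    by (simp add: gderiv_def)
  then show ?thesis
    using gradient_eqI by metis
qed

lemma GDERIV_imp_DERIV_along:
  assumes "GDERIV g (y + t *\<^sub>R d) :> v"
  shows "((\<lambda>t. g (y + t *\<^sub>R d)) has_real_derivative v \<bullet> d) (at t)"
proof -
  have "((\<lambda>t. y + t *\<^sub>R d) has_derivative (\<lambda>h. h *\<^sub>R d)) (at t)"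
    by (auto intro!: derivative_eq_intros)
  from has_derivative_compose[OF this assms[unfolded gderiv_def]]
  show ?thesis
    by (simp add: has_field_derivative_def inner_commute mult.commute[of _ "d \<bullet> v"])
qed

text \<open>Restriction to the line through \<open>y\<close> and \<open>u\<close> reduces this to
  the tangent inequality in one real variable.\<close>

lemma convex_on_GDERIV_tangent:
  assumes "convex_on UNIV g" "GDERIV g y :> v"
  shows "g y + v \<bullet> (u - y) \<le> g u"
proof -
  define h where "h t = g (y + t *\<^sub>R (u - y))" for t
  have "convex_on UNIV h"
  proof (rule convex_onI)
    fix t a b :: real
    assume t: "0 < t" "t < 1"
    have "y + ((1 - t) *\<^sub>R a + t *\<^sub>R b) *\<^sub>R (u - y)
        = (1 - t) *\<^sub>R (y + a *\<^sub>R (u - y)) + t *\<^sub>R (y + b *\<^sub>R (u - y))"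
      by (simp add: algebra_simps)
    then show "h ((1 - t) *\<^sub>R a + t *\<^sub>R b) \<le> (1 - t) * h a + t * h b"
      using convex_onD[OF assms(1), of t "y + a *\<^sub>R (u - y)" "y + b *\<^sub>R (u - y)"] t
      by (simp add: h_def)
  qed simp
  moreover have "(h has_real_derivative v \<bullet> (u - y)) (at 0)"
    using GDERIV_imp_DERIV_along[of g y 0 "u - y" v] assms(2) by (simp add: h_def[abs_def])
  ultimately have "h 1 - h 0 \<ge> (v \<bullet> (u - y)) * (1 - 0)"
    by (intro convex_on_imp_above_tangent[of UNIV]) auto
  then show ?thesis
    by (simp add: h_def)
qed

text \<open>Along the segment from \<open>y\<close> to \<open>x\<close>, the difference of
  \<open>g\<close> and its quadratic model has nonpositive derivative. A general \<open>D\<close>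
  lets this serve gradients in space and also \<open>logistic\<close>, the derivative of
  \<open>softplus\<close>.\<close>

lemma lipschitz_gradient_descent:
  assumes D: "\<And>x. GDERIV g x :> D x" and "L-lipschitz_on UNIV D"
  shows "g x \<le> g y + D y \<bullet> (x - y) + L / 2 * (norm (x - y))\<^sup>2"
proof -
  define d where "d = x - y"
  define h where "h t = g (y + t *\<^sub>R d) - t * (D y \<bullet> d) - L * t\<^sup>2 / 2 * (norm d)\<^sup>2" for t
  have "h 0 \<ge> h 1"
  proof (rule DERIV_nonpos_imp_nonincreasing[of 0 1 h])
    fix t :: real
    assume t: "0 \<le> t" "t \<le> 1"
    have "(h has_real_derivative D (y + t *\<^sub>R d) \<bullet> d - D y \<bullet> d - L * t * (norm d)\<^sup>2) (at t)"
      unfolding h_def[abs_def]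
      by (auto intro!: derivative_eq_intros GDERIV_imp_DERIV_along[OF D])
    moreover have "D (y + t *\<^sub>R d) \<bullet> d - D y \<bullet> d \<le> L * t * (norm d)\<^sup>2"
    proof -
      have "D (y + t *\<^sub>R d) \<bullet> d - D y \<bullet> d \<le> norm (D (y + t *\<^sub>R d) - D y) * norm d"
        by (metis inner_diff_left norm_cauchy_schwarz)
      also have "\<dots> \<le> (L * norm (t *\<^sub>R d)) * norm d"
        using lipschitz_onD[OF assms(2), of "y + t *\<^sub>R d" y]
        by (intro mult_right_mono) (simp_all add: dist_norm)
      finally show ?thesis
        using t by (simp add: power2_eq_square mult.assoc)
    qed
    ultimately show "\<exists>z. (h has_real_derivative z) (at t) \<and> z \<le> 0"
      by (intro exI[of _ "D (y + t *\<^sub>R d) \<bullet> d - D y \<bullet> d - L * t * (norm d)\<^sup>2"]) auto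
  qed simp
  then show ?thesis
    by (simp add: h_def d_def)
qed

lemma
  fixes g :: "'a::euclidean_space \<Rightarrow> real"
  assumes "smooth L g"
  shows smooth_GDERIV: "GDERIV g x :> gradient g x"
    and smooth_continuous_on: "continuous_on S g"
    and smooth_nonneg: "0 \<le> L"
    and smooth_descent: "g x \<le> g y + gradient g y \<bullet> (x - y) + L / 2 * (norm (x - y))\<^sup>2"
proof -
  have D: "GDERIV g x :> gradient g x" for x
    using assms by (simp add: smooth_def GDERIV_gradient)
  have L: "L-lipschitz_on UNIV (gradient g)"
    using assms by (simp add: smooth_def)
  show "GDERIV g x :> gradient g x" by (rule D)
  show "continuous_on S g"
    using assms by (metis smooth_def differentiable_imp_continuous_within
        continuous_at_imp_continuous_on)
  show "0 \<le> L" by (rule lipschitz_on_nonneg[OF L])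
  show "g x \<le> g y + gradient g y \<bullet> (x - y) + L / 2 * (norm (x - y))\<^sup>2"
    by (rule lipschitz_gradient_descent[OF D L])
qed

section \<open>From multipliers at the boundary to a global error bound\<close>

lemma convex_feasible:
  assumes "convex_on UNIV c"
  shows "convex (feasible c)"
  unfolding feasible_def convex_alt
proof clarify
  fix x y and t :: real
  assume "c x \<le> 0" "c y \<le> 0" "0 \<le> t" "t \<le> 1"
  then have "(1 - t) * c x + t * c y \<le> 0"
    by (intro add_nonpos_nonpos mult_nonneg_nonpos) auto
  then show "c ((1 - t) *\<^sub>R x + t *\<^sub>R y) \<le> 0"
    using convex_onD[OF assms, of t x y] \<open>0 \<le> t\<close> \<open>t \<le> 1\<close> by simp
qed

lemma closed_feasible:
  fixes c :: "'a::topological_space \<Rightarrow> real"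
  assumes "continuous_on UNIV c"
  shows "closed (feasible c)"
  unfolding feasible_def using assms by (intro closed_Collect_le) auto

text \<open>KKT conditions for the projection: \<open>x - u\<close> is a positive multiple of
  \<open>g\<close>, expressed as the equality case of Cauchy-Schwarz. The Slater point
  \<open>z\<close> excludes \<open>g = 0\<close> and supplies a direction of strict decrease at
  \<open>u\<close>.\<close>

lemma projection_inner_gradient:
  fixes c :: "'a::{real_inner,heine_borel} \<Rightarrow> real"
  assumes cvx: "convex_on UNIV c" and cont: "continuous_on UNIV c" and slater: "c z < 0"
    and x: "0 < c x" and u: "u = closest_point (feasible c) x" and g: "GDERIV c u :> g"
  shows "c u = 0" and "g \<noteq> 0" and "norm g * norm (x - u) \<le> g \<bullet> (x - u)"
proof -
  define w where "w = x - u"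
  have S: "convex (feasible c)" "closed (feasible c)" "feasible c \<noteq> {}"
    using convex_feasible[OF cvx] closed_feasible[OF cont] slater
    by (auto simp: feasible_def intro: less_imp_le)
  have cu: "c u \<le> 0"
    using closest_point_in_set[OF S(2,3), of x] by (simp add: u feasible_def)
  have w0: "w \<noteq> 0"
    using cu x by (auto simp: w_def)
  \<comment> \<open>The variational inequality of the projection, for directions that lead to a
    feasible point.\<close>
  have dir: "w \<bullet> d \<le> 0" if "0 < t" "c (u + t *\<^sub>R d) \<le> 0" for t d
  proof -
    have "w \<bullet> (t *\<^sub>R d) \<le> 0"
      using closest_point_dot[OF S(1,2), of "u + t *\<^sub>R d" x] that
      by (simp add: feasible_def w_def u)
    then show ?thesis
      using that by (simp add: mult_le_0_iff)
  qed
  show cu0: "c u = 0"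
  proof (rule ccontr)
    assume "c u \<noteq> 0"
    with cu have neg: "c u < 0" by simp
    \<comment> \<open>The chord from \<open>c u < 0\<close> to \<open>c x > 0\<close> crosses zero
      at \<open>s\<close>, so one could move from \<open>u\<close> towards \<open>x\<close> and stay
      feasible.\<close>
    define s where "s = - c u / (c x - c u)"
    have s: "0 < s" "s \<le> 1"
      using neg x by (auto simp: s_def field_simps)
    have "c (u + s *\<^sub>R w) \<le> (1 - s) * c u + s * c x"
      using convex_onD[OF cvx, of s u x] s by (simp add: w_def algebra_simps)
    also have "\<dots> = c u + s * (c x - c u)"
      by (simp add: algebra_simps)
    also have "\<dots> = 0"
      using neg x by (simp add: s_def)
    finally have "w \<bullet> w \<le> 0"
      by (rule dir[OF s(1)])
    with w0 show False
      by (metis inner_gt_zero_iff not_le)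
  qed
  have gz: "g \<bullet> (z - u) < 0"
    using convex_on_GDERIV_tangent[OF cvx g, of z] slater cu0 by simp
  then show g0: "g \<noteq> 0" by auto
  have strict: "w \<bullet> d \<le> 0" if "g \<bullet> d < 0" for d
  proof -
    have "((\<lambda>t. c (u + t *\<^sub>R d)) has_real_derivative g \<bullet> d) (at 0)"
      using GDERIV_imp_DERIV_along[of c u 0 d g] g by simp
    from DERIV_neg_dec_right[OF this that]
    obtain \<delta> where \<delta>: "0 < \<delta>" "\<forall>h>0. h < \<delta> \<longrightarrow> c (u + h *\<^sub>R d) < c u"
      by auto
    then have "c (u + (\<delta> / 2) *\<^sub>R d) < c u"
      by (metis field_sum_of_halves half_gt_zero less_add_same_cancel1)
    with cu0 \<delta>(1) show ?thesis
      by (intro dir[of "\<delta> / 2"]) auto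
  qed
  \<comment> \<open>Tilting \<open>d\<close> towards the Slater point makes it strictly decreasing;
    \<open>e\<close> is so small that the tilt lowers \<open>w \<bullet> d\<close> by at most
    half.\<close>
  have weak: "w \<bullet> d \<le> 0" if "g \<bullet> d \<le> 0" for d
  proof (rule ccontr)
    assume "\<not> w \<bullet> d \<le> 0"
    define b where "b = \<bar>w \<bullet> (z - u)\<bar> + 1"
    define e where "e = w \<bullet> d / (2 * b)"
    have b: "0 < b" "- b < w \<bullet> (z - u)"
      by (auto simp: b_def)
    then have e: "0 < e"
      using \<open>\<not> w \<bullet> d \<le> 0\<close> by (simp add: e_def)
    have "g \<bullet> (d + e *\<^sub>R (z - u)) < 0"
      using that gz e by (simp add: inner_add_right add_nonpos_neg mult_pos_neg)
    from strict[OF this] have "w \<bullet> d + e * (w \<bullet> (z - u)) \<le> 0"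
      by (simp add: inner_add_right)
    moreover have "e * (- b) \<le> e * (w \<bullet> (z - u))"
      using b e by (intro mult_left_mono) auto
    moreover have "e * b = w \<bullet> d / 2"
      using b by (simp add: e_def)
    ultimately show False
      using \<open>\<not> w \<bullet> d \<le> 0\<close> by simp
  qed
  have gw: "0 < g \<bullet> w"
    using weak[of w] w0 by (metis inner_gt_zero_iff not_le)
  have gg: "0 < g \<bullet> g"
    using g0 by simp
  \<comment> \<open>For the component of \<open>w\<close> orthogonal to \<open>g\<close>, the
    inequality \<open>w \<bullet> d \<le> 0\<close> is the reverse of Cauchy-Schwarz.\<close>
  define d where "d = w - (g \<bullet> w / (g \<bullet> g)) *\<^sub>R g"
  have "g \<bullet> d = 0"
    using gg by (simp add: d_def inner_diff_right)
  then have "w \<bullet> d \<le> 0"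
    using weak by simp
  then have "w \<bullet> w \<le> (g \<bullet> w)\<^sup>2 / (g \<bullet> g)"
    by (simp add: d_def inner_diff_right inner_commute power2_eq_square)
  then have "(norm g * norm w)\<^sup>2 \<le> (g \<bullet> w)\<^sup>2"
    using gg by (simp add: power_mult_distrib power2_norm_eq_inner field_simps)
  then show "norm g * norm (x - u) \<le> g \<bullet> (x - u)"
    using gw power2_le_imp_le[of "norm g * norm w" "g \<bullet> w"] by (simp add: w_def)
qed

text \<open>Under the subgradient alternative, the tangent of \<open>c\<close> at the projection,
  where \<open>c\<close> vanishes, bounds \<open>c x\<close> below by the norm of the gradient times
  the distance, and that norm is at least \<open>\<rho>\<close>.\<close>

lemma regularity_error_bound:
  fixes c :: "'a::euclidean_space \<Rightarrow> real"
  assumes "convex_on UNIV c" "smooth L c" "0 < \<rho>" "regularity c \<rho>" "\<exists>z. c z < 0"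
  shows "\<rho> * norm (x - closest_point (feasible c) x) \<le> max (c x) 0"
proof (cases "\<forall>x v. c x = 0 \<and> v \<in> subdifferential c x \<and> v \<noteq> 0 \<longrightarrow> \<rho> \<le> norm v")
  case False
  then have "norm (closest_point (feasible c) x - x) \<le> max (c x) 0 / \<rho>"
    using assms(4) unfolding regularity_def by blast
  then show ?thesis
    using assms(3) by (simp add: field_simps norm_minus_commute)
next
  case True
  define u where "u = closest_point (feasible c) x"
  show ?thesis
  proof (cases "0 < c x")
    case False
    then have "x \<in> feasible c"
      by (simp add: feasible_def)
    then show ?thesis
      by (simp add: closest_point_self)
  next
    case pos: True
    obtain z where z: "c z < 0" using assms(5) by blast
    note g = smooth_GDERIV[OF assms(2), of u]
    note kkt = projection_inner_gradient[OF assms(1) smooth_continuous_on[OF assms(2)] z pos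
        u_def g]
    have "gradient c u \<in> subdifferential c u"
      using convex_on_GDERIV_tangent[OF assms(1) g] by (simp add: subdifferential_def)
    with True kkt have "\<rho> \<le> norm (gradient c u)"
      by blast
    then have "\<rho> * norm (x - u) \<le> norm (gradient c u) * norm (x - u)"
      by (rule mult_right_mono) simp
    also have "\<dots> \<le> c x"
      using convex_on_GDERIV_tangent[OF assms(1) g, of x] kkt by simp
    finally show ?thesis
      by (simp add: u_def)
  qed
qed

section \<open>The softplus penalty\<close>

definition softplus :: "real \<Rightarrow> real" where
  "softplus a = ln (1 + exp a)"

definition logistic :: "real \<Rightarrow> real" where
  "logistic a = exp a / (1 + exp a)"

lemma one_plus_exp_pos: "0 < 1 + exp (a::real)"
  by (simp add: add_pos_pos)

lemma logistic_bounds: "0 < logistic a" "logistic a < 1"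
  using one_plus_exp_pos[of a] by (auto simp: logistic_def)

lemma DERIV_softplus: "(softplus has_real_derivative logistic a) (at a)"
  unfolding softplus_def[abs_def] logistic_def using one_plus_exp_pos[of a]
  by (auto intro!: derivative_eq_intros)

lemma DERIV_logistic: "(logistic has_real_derivative logistic a * (1 - logistic a)) (at a)"
  unfolding logistic_def[abs_def] using one_plus_exp_pos[of a]
  by (auto intro!: derivative_eq_intros simp: field_simps power2_eq_square)

text \<open>The maximum 1/4 of s(1 - s) is the source of the 4 in
  \<open>penalized_smoothness\<close>; halved, it is the 1/8 of
  \<open>softplus_upper\<close>.\<close>

lemma lipschitz_on_logistic: "(1 / 4)-lipschitz_on UNIV logistic"
proof (rule lipschitz_onI)
  fix a b :: real
  have *: "norm (logistic x * (1 - logistic x)) \<le> 1 / 4" for x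
  proof -
    have "0 \<le> (logistic x - 1 / 2)\<^sup>2" by simp
    then have "logistic x * (1 - logistic x) \<le> 1 / 4"
      by (simp add: power2_eq_square field_simps)
    moreover have "0 \<le> logistic x * (1 - logistic x)"
      using logistic_bounds[of x] by simp
    ultimately show ?thesis by simp
  qed
  have "norm (logistic a - logistic b) \<le> 1 / 4 * norm (a - b)"
    by (rule field_differentiable_bound[where S = UNIV]) (use DERIV_logistic * in auto)
  then show "dist (logistic a) (logistic b) \<le> 1 / 4 * dist a b"
    by (simp add: dist_norm)
qed simp

lemma softplus_upper: "softplus b \<le> softplus a + logistic a * (b - a) + (b - a)\<^sup>2 / 8"
  using lipschitz_gradient_descent[of softplus logistic "1 / 4" b a]
    DERIV_softplus lipschitz_on_logistic by simp

lemma convex_on_softplus: "convex_on UNIV softplus"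
  by (rule f''_ge0_imp_convex[OF _ DERIV_softplus DERIV_logistic])
    (use logistic_bounds in \<open>auto intro!: mult_nonneg_nonneg intro: less_imp_le\<close>)

lemma softplus_lower: "softplus a + logistic a * (b - a) \<le> softplus b"
  using convex_on_GDERIV_tangent[OF convex_on_softplus, of a "logistic a" b] DERIV_softplus
  by simp

lemma max_le_softplus: "max a 0 \<le> softplus a"
proof -
  have "a = ln (exp a)" by simp
  also have "\<dots> \<le> softplus a"
    unfolding softplus_def by (subst ln_le_cancel_iff) (auto simp: one_plus_exp_pos)
  finally show ?thesis
    by (simp add: softplus_def)
qed

lemma softplus_le_ln2: "a \<le> 0 \<Longrightarrow> softplus a \<le> ln 2"
  unfolding softplus_def by (subst ln_le_cancel_iff) (auto simp: one_plus_exp_pos)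

lemma penalized_softplus:
  "penalized f c lam \<gamma> x = f x + \<gamma> * softplus (lam * c x / \<gamma>)"
  by (simp add: penalized_def softplus_def)

text \<open>Together with \<open>penalized_upper\<close> this relates the smoothed penalty to the
  exact one: nothing is lost from below, and at feasible points the smoothing costs at most
  \<open>\<gamma> * ln 2\<close>.\<close>

lemma penalized_lower:
  assumes "0 < \<gamma>" "0 \<le> lam"
  shows "f x + lam * max (c x) 0 \<le> penalized f c lam \<gamma> x"
proof -
  have "lam * max (c x) 0 = \<gamma> * max (lam * c x / \<gamma>) 0"
    using assms by (auto simp: max_def mult_le_0_iff divide_le_0_iff)
  also have "\<dots> \<le> \<gamma> * softplus (lam * c x / \<gamma>)"
    using assms max_le_softplus by (intro mult_left_mono) auto
  finally show ?thesis
    by (simp add: penalized_softplus)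
qed

lemma penalized_upper:
  assumes "0 < \<gamma>" "0 \<le> lam" "c x \<le> 0"
  shows "penalized f c lam \<gamma> x \<le> f x + \<gamma> * ln 2"
  using assms softplus_le_ln2[of "lam * c x / \<gamma>"]
  by (simp add: penalized_softplus mult_nonneg_nonpos divide_nonpos_pos)

definition penalized_gradient where
  "penalized_gradient f c lam \<gamma> x
    = gradient f x + (lam * logistic (lam * c x / \<gamma>)) *\<^sub>R gradient c x"

context
  fixes f c :: "'a::euclidean_space \<Rightarrow> real" and L\<^sub>f L\<^sub>c G\<^sub>c lam \<gamma> :: real
  assumes f: "smooth L\<^sub>f f" "convex_on UNIV f"
    and c: "smooth L\<^sub>c c" "convex_on UNIV c" "G\<^sub>c-lipschitz_on UNIV c"
    and pos: "0 < \<gamma>" "0 \<le> lam"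
begin

lemma penalized_GDERIV:
  "GDERIV (penalized f c lam \<gamma>) x :> penalized_gradient f c lam \<gamma> x"
proof -
  have "((\<lambda>s. \<gamma> * softplus (lam * s / \<gamma>)) has_real_derivative
      lam * logistic (lam * c x / \<gamma>)) (at (c x))"
  proof -
    have "((\<lambda>s. lam * s / \<gamma>) has_real_derivative lam / \<gamma>) (at (c x))"
      using pos by (auto intro!: derivative_eq_intros)
    from DERIV_cmult[OF DERIV_chain2[OF DERIV_softplus this], of \<gamma>] show ?thesis
      using pos by (simp add: mult.commute[of lam "logistic _"])
  qed
  from GDERIV_add[OF smooth_GDERIV[OF f(1)] GDERIV_DERIV_compose[OF smooth_GDERIV[OF c(1)] this]]
  show ?thesis
    by (simp add: penalized_softplus[abs_def] penalized_gradient_def)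
qed

text \<open>Softplus is convex and increasing, so the tangent inequality of \<open>c\<close> may be
  multiplied by the positive slope \<open>logistic a\<close> and chained with that of
  \<open>softplus\<close>.\<close>

lemma penalized_tangent:
  "penalized f c lam \<gamma> y + penalized_gradient f c lam \<gamma> y \<bullet> (u - y) \<le> penalized f c lam \<gamma> u"
proof -
  define a b where "a = lam * c y / \<gamma>" and "b = lam * c u / \<gamma>"
  have "lam * (gradient c y \<bullet> (u - y)) \<le> lam * (c u - c y)"
    using convex_on_GDERIV_tangent[OF c(2) smooth_GDERIV[OF c(1)], of y u] pos
    by (intro mult_left_mono) auto
  also have "\<dots> = \<gamma> * (b - a)"
    using pos by (simp add: a_def b_def field_simps)
  finally have "logistic a * (lam * (gradient c y \<bullet> (u - y))) \<le> logistic a * (\<gamma> * (b - a))"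
    using logistic_bounds[of a] by (intro mult_left_mono) auto
  also have "\<dots> \<le> \<gamma> * softplus b - \<gamma> * softplus a"
    using mult_left_mono[OF softplus_lower[of a b], of \<gamma>] pos by (simp add: algebra_simps)
  finally show ?thesis
    using convex_on_GDERIV_tangent[OF f(2) smooth_GDERIV[OF f(1)], of y u]
    by (simp add: penalized_softplus penalized_gradient_def a_def b_def inner_add_left mult_ac)
qed

text \<open>The three terms of the constant come from the curvature of \<open>f\<close>, from that
  of \<open>c\<close> seen through a slope below 1, and from that of \<open>softplus\<close>, whose
  argument varies at rate at most \<open>lam * G\<^sub>c / \<gamma>\<close>.\<close>

lemma penalized_descent:
  "penalized f c lam \<gamma> x \<le> penalized f c lam \<gamma> y + penalized_gradient f c lam \<gamma> y \<bullet> (x - y)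
    + penalized_smoothness L\<^sub>f L\<^sub>c G\<^sub>c lam \<gamma> / 2 * (norm (x - y))\<^sup>2"
proof -
  define a b where "a = lam * c y / \<gamma>" and "b = lam * c x / \<gamma>"
  define n where "n = (norm (x - y))\<^sup>2"
  have "\<gamma> * (b - a) = lam * (c x - c y)"
    using pos by (simp add: a_def b_def field_simps)
  also have "\<dots> \<le> lam * (gradient c y \<bullet> (x - y) + L\<^sub>c / 2 * n)"
    using smooth_descent[OF c(1), of x y] pos by (intro mult_left_mono) (auto simp: n_def)
  finally have "logistic a * (\<gamma> * (b - a))
      \<le> logistic a * (lam * (gradient c y \<bullet> (x - y) + L\<^sub>c / 2 * n))"
    using logistic_bounds[of a] by (intro mult_left_mono) auto
  also have "\<dots> = lam * logistic a * (gradient c y \<bullet> (x - y)) + logistic a * (lam * L\<^sub>c / 2 * n)"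
    by (simp add: algebra_simps)
  also have "logistic a * (lam * L\<^sub>c / 2 * n) \<le> lam * L\<^sub>c / 2 * n"
    using logistic_bounds[of a] smooth_nonneg[OF c(1)] pos
    by (intro mult_left_le_one_le) (auto simp: n_def)
  finally have lin: "\<gamma> * (logistic a * (b - a))
      \<le> lam * logistic a * (gradient c y \<bullet> (x - y)) + lam * L\<^sub>c / 2 * n"
    by (simp add: mult_ac)
  have "\<bar>c x - c y\<bar> \<le> G\<^sub>c * norm (x - y)"
    using lipschitz_onD[OF c(3), of x y] by (simp add: dist_norm)
  then have "(c x - c y)\<^sup>2 \<le> (G\<^sub>c * norm (x - y))\<^sup>2"
    by (metis abs_ge_zero power2_abs power_mono)
  then have "lam\<^sup>2 * (c x - c y)\<^sup>2 / (8 * \<gamma>) \<le> lam\<^sup>2 * (G\<^sub>c\<^sup>2 * n) / (8 * \<gamma>)"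
    using pos by (intro divide_right_mono mult_left_mono) (auto simp: n_def power_mult_distrib)
  moreover have "\<gamma> * ((b - a)\<^sup>2 / 8) = lam\<^sup>2 * (c x - c y)\<^sup>2 / (8 * \<gamma>)"
    using pos by (simp add: a_def b_def field_simps power2_eq_square)
  moreover have "\<gamma> * softplus b
      \<le> \<gamma> * softplus a + \<gamma> * (logistic a * (b - a)) + \<gamma> * ((b - a)\<^sup>2 / 8)"
    using mult_left_mono[OF softplus_upper[of b a], of \<gamma>] pos by (simp add: distrib_left)
  ultimately have "\<gamma> * softplus b \<le> \<gamma> * softplus a
      + (lam * logistic a * (gradient c y \<bullet> (x - y)) + lam * L\<^sub>c / 2 * n)
      + lam\<^sup>2 * (G\<^sub>c\<^sup>2 * n) / (8 * \<gamma>)"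
    using lin by linarith
  moreover have "penalized_smoothness L\<^sub>f L\<^sub>c G\<^sub>c lam \<gamma> / 2 * n
      = L\<^sub>f / 2 * n + lam * L\<^sub>c / 2 * n + lam\<^sup>2 * (G\<^sub>c\<^sup>2 * n) / (8 * \<gamma>)"
    using pos by (simp add: penalized_smoothness_def field_simps)
  ultimately show ?thesis
    using smooth_descent[OF f(1), of x y]
    unfolding penalized_softplus penalized_gradient_def inner_add_left inner_scaleR_left
      a_def[symmetric] b_def[symmetric] n_def[symmetric]
    by linarith
qed

end

section \<open>Nesterov's method\<close>

text \<open>This linear growth turns the potential bound into a rate of order 1/s^2.\<close>

lemma \<tau>_ge: "real s / 2 + 1 \<le> \<tau> s"
proof (induction s)
  case (Suc s)
  have "2 * \<tau> s \<le> sqrt (1 + 4 * (\<tau> s)\<^sup>2)"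
    by (rule real_le_rsqrt) (simp add: power_mult_distrib)
  with Suc show ?case by (simp add: field_simps)
qed simp

lemma \<tau>_ge_1: "1 \<le> \<tau> s"
  using \<tau>_ge[of s] by simp

text \<open>The recursion picks the positive root of this quadratic, which makes the weights in
  \<open>nag_potential\<close> telescope.\<close>

lemma \<tau>_Suc_square: "(\<tau> (Suc s))\<^sup>2 - \<tau> (Suc s) = (\<tau> s)\<^sup>2"
proof -
  have "(sqrt (1 + 4 * (\<tau> s)\<^sup>2))\<^sup>2 = 1 + 4 * (\<tau> s)\<^sup>2"
    by simp
  then show ?thesis
    by (simp add: power2_eq_square field_simps)
qed

context
  fixes F :: "'a::real_inner \<Rightarrow> real" and D :: "'a \<Rightarrow> 'a" and L :: real
  assumes D: "\<And>y. GDERIV F y :> D y"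
    and tangent: "\<And>y u. F y + D y \<bullet> (u - y) \<le> F u"
    and descent: "\<And>x y. F x \<le> F y + D y \<bullet> (x - y) + L / 2 * (norm (x - y))\<^sup>2"
    and L: "0 < L"
begin

text \<open>The quadratic model gives the decrease of a step of length 1/L, and the tangent
  inequality replaces \<open>F y\<close> by \<open>F u\<close>. It is applied with \<open>u\<close>
  the comparison point and with \<open>u\<close> the current iterate.\<close>

lemma gradient_step:
  "F (y - (1 / L) *\<^sub>R D y) \<le> F u + D y \<bullet> (y - u) - (D y \<bullet> D y) / (2 * L)"
proof -
  have "F (y - (1 / L) *\<^sub>R D y) \<le> F y - (D y \<bullet> D y) / (2 * L)"
    using descent[of "y - (1 / L) *\<^sub>R D y" y] L unfolding power2_norm_eq_inner
    by (simp add: field_simps)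
  with tangent[of y u] show ?thesis
    by (simp add: inner_diff_right)
qed

text \<open>The vector \<open>\<tau>\<^sub>s y\<^sub>s - (\<tau>\<^sub>s - 1) x\<^sub>s\<close> moves by exactly \<open>- (\<tau>\<^sub>s / L) \<nabla>F(y\<^sub>s)\<close>, so its squared
  distance to \<open>u\<close> absorbs the gradient terms of the two instances of \<open>gradient_step\<close>.\<close>
lemma nag_potential:
  fixes u z :: 'a
  defines "v s \<equiv> \<tau> s *\<^sub>R snd (nag F L z s) - (\<tau> s - 1) *\<^sub>R fst (nag F L z s) - u"
  shows "(\<tau> s)\<^sup>2 * (F (fst (nag F L z (Suc s))) - F u) + L / 2 * (norm (v (Suc s)))\<^sup>2
    \<le> ((\<tau> s)\<^sup>2 - \<tau> s) * (F (fst (nag F L z s)) - F u) + L / 2 * (norm (v s))\<^sup>2"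
proof -
  obtain x y where xy: "nag F L z s = (x, y)" by fastforce
  define g where "g = D y"
  define x' where "x' = y - (1 / L) *\<^sub>R g"
  define E where "E = (g \<bullet> g) / (2 * L)"
  define T where "T = \<tau> s"
  have T: "1 \<le> T" using \<tau>_ge_1 by (simp add: T_def)
  have nag': "nag F L z (Suc s) = (x', x' + \<beta> (Suc s) *\<^sub>R (x' - x))"
    by (simp add: xy x'_def g_def gradient_eqI[OF D] Let_def)
  \<comment> \<open>The momentum coefficient is designed so that \<open>\<tau> (Suc s)\<close> drops
    out of \<open>v (Suc s)\<close>.\<close>
  have \<beta>: "\<tau> (Suc s) * \<beta> (Suc s) = T - 1"
    using \<tau>_ge_1[of "Suc s"] by (simp add: \<beta>_def T_def del: \<tau>.simps)
  then have v': "v (Suc s) = T *\<^sub>R x' - (T - 1) *\<^sub>R x - u"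
    unfolding v_def nag' fst_conv snd_conv scaleR_add_right scaleR_scaleR \<beta>
    by (simp add: algebra_simps del: \<tau>.simps)
  have vs: "v s = T *\<^sub>R y - (T - 1) *\<^sub>R x - u"
    by (simp add: v_def xy T_def)
  have v_step: "v (Suc s) = v s - (T / L) *\<^sub>R g"
    by (simp add: v' vs x'_def algebra_simps)
  have "L / 2 * (norm (v (Suc s)))\<^sup>2 = L / 2 * (norm (v s))\<^sup>2 - T * (g \<bullet> v s) + T\<^sup>2 * E"
    using L unfolding v_step power2_norm_eq_inner
    by (simp add: inner_diff_left inner_diff_right inner_commute field_simps power2_eq_square E_def)
  moreover have "T * (g \<bullet> v s) = (T\<^sup>2 - T) * (g \<bullet> (y - x)) + T * (g \<bullet> (y - u))"
    by (simp add: vs inner_diff_right algebra_simps power2_eq_square)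
  \<comment> \<open>The weights \<open>T\<^sup>2 - T\<close> and \<open>T\<close> add up to
    \<open>T\<^sup>2\<close> and reproduce the two inner products of the preceding line.\<close>
  moreover have "(T\<^sup>2 - T) * F x' \<le> (T\<^sup>2 - T) * (F x + g \<bullet> (y - x) - E)"
    using gradient_step[of y x] T
    by (intro mult_left_mono) (auto simp: x'_def g_def E_def power2_eq_square)
  moreover have "T * F x' \<le> T * (F u + g \<bullet> (y - u) - E)"
    using gradient_step[of y u] T by (intro mult_left_mono) (auto simp: x'_def g_def E_def)
  ultimately show ?thesis
    unfolding nag' xy fst_conv T_def[symmetric] by (simp add: algebra_simps)
qed

text \<open>The point \<open>u\<close> is arbitrary because an epoch compares with a near-optimal
  feasible point, not with a minimizer of \<open>F\<close>; the gap may therefore be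
  negative.\<close>

lemma nag_rate:
  "F (fst (nag F L z (Suc s))) - F u \<le> 2 * L * (norm (z - u))\<^sup>2 / (real (Suc s))\<^sup>2"
proof -
  define \<delta> where "\<delta> s = F (fst (nag F L z s)) - F u" for s
  define v where "v s = \<tau> s *\<^sub>R snd (nag F L z s) - (\<tau> s - 1) *\<^sub>R fst (nag F L z s) - u" for s
  have step: "(\<tau> s)\<^sup>2 * \<delta> (Suc s) + L / 2 * (norm (v (Suc s)))\<^sup>2
      \<le> ((\<tau> s)\<^sup>2 - \<tau> s) * \<delta> s + L / 2 * (norm (v s))\<^sup>2" for s
    unfolding \<delta>_def v_def by (rule nag_potential)
  have "(\<tau> s)\<^sup>2 * \<delta> (Suc s) + L / 2 * (norm (v (Suc s)))\<^sup>2 \<le> L / 2 * (norm (z - u))\<^sup>2"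
  proof (induction s)
    case 0
    \<comment> \<open>As \<open>\<tau> 0 = 1\<close>, the weight of the initial gap vanishes and
      \<open>v 0 = z - u\<close>.\<close>
    show ?case using step[of 0] by (simp add: v_def)
  next
    case (Suc s)
    then show ?case
      using step[of "Suc s"] unfolding \<tau>_Suc_square by linarith
  qed
  moreover have "0 \<le> L / 2 * (norm (v (Suc s)))\<^sup>2"
    using L by simp
  ultimately have *: "(\<tau> s)\<^sup>2 * \<delta> (Suc s) \<le> L / 2 * (norm (z - u))\<^sup>2"
    by linarith
  show ?thesis
  \<comment> \<open>Replacing \<open>\<tau> s\<close> by its lower bound is legitimate only for a
    nonnegative gap.\<close>
  proof (cases "\<delta> (Suc s) \<le> 0")
    case True
    moreover have "0 \<le> 2 * L * (norm (z - u))\<^sup>2 / (real (Suc s))\<^sup>2"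
      using L by simp
    ultimately show ?thesis
      unfolding \<delta>_def by linarith
  next
    case False
    have "(real (Suc s) / 2)\<^sup>2 \<le> (\<tau> s)\<^sup>2"
      using \<tau>_ge[of s] by (intro power_mono) auto
    then have "(real (Suc s) / 2)\<^sup>2 * \<delta> (Suc s) \<le> (\<tau> s)\<^sup>2 * \<delta> (Suc s)"
      using False by (intro mult_right_mono) auto
    with * have "(real (Suc s) / 2)\<^sup>2 * \<delta> (Suc s) \<le> L / 2 * (norm (z - u))\<^sup>2"
      by linarith
    then have "\<delta> (Suc s) * (real (Suc s))\<^sup>2 \<le> 2 * L * (norm (z - u))\<^sup>2"
      by (simp add: power_divide mult.commute)
    then show ?thesis
      unfolding \<delta>_def[symmetric] by (simp add: pos_le_divide_eq)
  qed
qed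

end

section \<open>One epoch\<close>

lemma opt_val_eq: "x \<in> opt_set f c \<Longrightarrow> opt_val f c = f x"
  unfolding opt_val_def opt_set_def by (intro cInf_eq_minimum) auto

text \<open>The chord from an optimal \<open>v\<close> to \<open>x\<close> meets the sublevel set at
  \<open>z\<close>, so the projection \<open>u\<close> is no farther from \<open>x\<close> than
  \<open>z\<close>. With \<open>dist u v \<le> D\<close> this is a linear inequality for
  \<open>dist x u\<close> alone.\<close>

lemma dist_sublevel:
  fixes f c :: "'a::euclidean_space \<Rightarrow> real"
  assumes f: "convex_on UNIV f" "continuous_on UNIV f"
    and c: "convex_on UNIV c" "continuous_on UNIV c"
    and opt: "opt_set f c \<noteq> {}" "closed (opt_set f c)"
    and leb: "local_error_bound f c \<epsilon> \<theta> \<sigma>" and pos: "0 < \<epsilon>" "0 < \<theta>" "0 < \<sigma>"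
    and x: "x \<in> feasible c" "f x - opt_val f c \<le> \<epsilon> + \<epsilon>'" "0 \<le> \<epsilon>'"
  obtains u where "u \<in> sublevel f c \<epsilon>" "norm (x - u) \<le> \<sigma> / \<epsilon> powr (1 - \<theta>) * \<epsilon>'"
proof (cases "x \<in> sublevel f c \<epsilon>")
  case True
  then show ?thesis
    using that[of x] pos x(3) by simp
next
  case False
  define r where "r = opt_val f c"
  define u where "u = closest_point (sublevel f c \<epsilon>) x"
  define D where "D = \<sigma> * \<epsilon> powr \<theta>"
  \<comment> \<open>The position on the chord at which the linearly interpolated gap equals
    \<open>\<epsilon>\<close>.\<close>
  define s where "s = \<epsilon> / (f x - r)"
  have gap: "\<epsilon> < f x - r"
    using False x(1) by (auto simp: sublevel_def r_def)
  have s: "0 < s" "s < 1"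
    using gap pos by (auto simp: s_def)
  have "sublevel f c \<epsilon> = feasible c \<inter> {x. f x \<le> r + \<epsilon>}"
    by (auto simp: sublevel_def r_def)
  moreover have "closed {x. f x \<le> r + \<epsilon>}"
    using f(2) by (intro closed_Collect_le) auto
  ultimately have closed: "closed (sublevel f c \<epsilon>)"
    using closed_feasible[OF c(2)] by auto
  obtain q where q: "q \<in> opt_set f c"
    using opt(1) by blast
  then have "q \<in> sublevel f c \<epsilon>"
    using opt_val_eq[OF q] pos by (simp add: sublevel_def opt_set_def)
  then have u: "u \<in> sublevel f c \<epsilon>"
    unfolding u_def using closest_point_in_set[OF closed] by blast
  \<comment> \<open>The optimal point is chosen nearest to \<open>u\<close>, not to
    \<open>x\<close>: the error bound is available only inside the sublevel set.\<close>
  obtain v where v: "v \<in> opt_set f c" "infdist u (opt_set f c) = dist u v"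
    using infdist_attains_inf[OF opt(2,1)] by blast
  have fv: "f v = r"
    using opt_val_eq[OF v(1)] by (simp add: r_def)
  have "0 \<le> f u - r" "f u - r \<le> \<epsilon>"
    using u v(1) fv by (auto simp: sublevel_def opt_set_def r_def)
  then have "(f u - r) powr \<theta> \<le> \<epsilon> powr \<theta>"
    using pos by (intro powr_mono2) auto
  then have "\<sigma> * (f u - r) powr \<theta> \<le> D"
    using pos by (simp add: D_def)
  with leb u v(2) have uv: "dist u v \<le> D"
    unfolding local_error_bound_def r_def by fastforce
  define z where "z = (1 - s) *\<^sub>R v + s *\<^sub>R x"
  have "z \<in> feasible c"
    using convexD[OF convex_feasible[OF c(1)], of v x "1 - s" s] v(1) x(1) s
    by (simp add: z_def opt_set_def)
  moreover have "f z \<le> (1 - s) * f v + s * f x"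
    unfolding z_def using convex_onD[OF f(1), of s v x] s by simp
  moreover have "(1 - s) * f v + s * f x = r + s * (f x - r)"
    by (simp add: fv algebra_simps)
  moreover have "s * (f x - r) = \<epsilon>"
    using gap pos by (simp add: s_def)
  ultimately have "z \<in> sublevel f c \<epsilon>"
    by (simp add: sublevel_def r_def)
  then have "dist x u \<le> dist x z"
    unfolding u_def by (rule closest_point_le[OF closed])
  also have "dist x z = (1 - s) * dist x v"
  proof -
    have "x - z = (1 - s) *\<^sub>R (x - v)"
      by (simp add: z_def algebra_simps)
    with s show ?thesis
      by (simp add: dist_norm)
  qed
  also have "\<dots> \<le> (1 - s) * (dist x u + D)"
    using s uv dist_triangle[of x v u] by (intro mult_left_mono) auto
  finally have "s * dist x u \<le> (1 - s) * D"
    by (simp add: algebra_simps)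
  then have "s * dist x u * (f x - r) \<le> (1 - s) * D * (f x - r)"
    using gap pos by (intro mult_right_mono) auto
  also have "\<dots> = D * (f x - r - s * (f x - r))"
    by (simp add: algebra_simps)
  also have "s * dist x u * (f x - r) = dist x u * (s * (f x - r))"
    by simp
  finally have "dist x u * \<epsilon> \<le> D * (f x - r - \<epsilon>)"
    unfolding \<open>s * (f x - r) = \<epsilon>\<close> .
  also have "\<dots> \<le> D * \<epsilon>'"
    using x(2) pos by (intro mult_left_mono) (auto simp: D_def r_def)
  finally have "dist x u \<le> D / \<epsilon> * \<epsilon>'"
    using pos by (simp add: field_simps)
  also have "D / \<epsilon> = \<sigma> / \<epsilon> powr (1 - \<theta>)"
    using pos by (simp add: D_def powr_diff)
  finally show ?thesis
    using that[OF u] by (simp add: dist_norm)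
qed

text \<open>Projecting raises \<open>f\<close> by at most \<open>G * d\<close>, hence by at most
  \<open>lam * max (c x) 0\<close>, which the penalized value at \<open>x\<close> already contains;
  \<open>\<gamma> * ln 2\<close> is the smoothing cost at \<open>u\<close>.\<close>

lemma penalty_projection:
  fixes f c :: "'a::euclidean_space \<Rightarrow> real"
  assumes pos: "0 < \<gamma>" "0 \<le> lam" and G: "G-lipschitz_on UNIV f" "G \<le> lam * \<rho>"
    and reg: "\<rho> * norm (x - closest_point (feasible c) x) \<le> max (c x) 0"
    and u: "u \<in> feasible c"
  shows "f (closest_point (feasible c) x) - f u
    \<le> \<gamma> * ln 2 + (penalized f c lam \<gamma> x - penalized f c lam \<gamma> u)"
proof -
  define d where "d = norm (x - closest_point (feasible c) x)"
  have "f (closest_point (feasible c) x) - f x \<le> G * d"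
    using lipschitz_onD[OF G(1), of "closest_point (feasible c) x" x]
    by (simp add: d_def dist_norm norm_minus_commute)
  also have "\<dots> \<le> lam * \<rho> * d"
    using G(2) by (intro mult_right_mono) (auto simp: d_def)
  also have "\<dots> \<le> lam * max (c x) 0"
    using mult_left_mono[OF reg pos(2)] by (simp add: d_def mult.assoc)
  finally show ?thesis
    using penalized_lower[OF pos, of f x c] penalized_upper[OF pos, of c u f] u
    by (simp add: feasible_def)
qed

text \<open>With \<open>e\<close> in the role of \<open>\<epsilon>\<^sub>0 / 2\<^bsup>k-1\<^esup>\<close>, the penalty costs \<open>\<gamma> ln 2 = e / (6p) \<le> e / 6\<close> and the
  inner loop is run long enough to leave an error of at most \<open>e / 3\<close>.\<close>
lemma epoch_error:
  fixes A B p e \<gamma> m M t n :: real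
  assumes p: "1 \<le> p" and e: "0 < e" and A: "0 \<le> A"
    and \<gamma>: "\<gamma> = e / (6 * p * ln 2)"
    and m: "m = max (B * p * sqrt (18 * ln 2)) (sqrt (12 * A * e))" and "0 \<le> B" "0 < m"
    and t: "M * m \<le> t" and M: "0 < M" and n: "0 \<le> n" "n \<le> M * e"
  shows "\<gamma> * ln 2 + 2 * (A + B\<^sup>2 / (4 * \<gamma>)) * n\<^sup>2 / t\<^sup>2 \<le> e / 2"
proof -
  define L where "L = A + B\<^sup>2 / (4 * \<gamma>)"
  have ln2: "0 < ln (2::real)" by simp
  have L: "0 \<le> L"
    using A p e by (simp add: L_def \<gamma>)
  have "sqrt (12 * A * e) \<le> m"
    by (simp add: m)
  then have "(sqrt (12 * A * e))\<^sup>2 \<le> m\<^sup>2"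
    by (rule power_mono) (use A e in simp)
  then have mA: "12 * A * e \<le> m\<^sup>2"
    using A e by simp
  have "B * p * sqrt (18 * ln 2) \<le> m"
    by (simp add: m)
  then have "(B * p * sqrt (18 * ln 2))\<^sup>2 \<le> m\<^sup>2"
    by (rule power_mono) (use assms in simp)
  then have "18 * ln 2 * (B\<^sup>2 * p\<^sup>2) \<le> m\<^sup>2"
    by (simp add: power_mult_distrib mult.commute)
  moreover have "p \<le> p\<^sup>2"
    using p by (simp add: power2_eq_square)
  \<comment> \<open>The term \<open>B\<^sup>2 / (4 * \<gamma>)\<close> of \<open>L\<close> is linear
    in \<open>p\<close>, whereas \<open>m\<^sup>2\<close> controls \<open>p\<^sup>2\<close>.\<close>
  then have "18 * ln 2 * (B\<^sup>2 * p) \<le> 18 * ln 2 * (B\<^sup>2 * p\<^sup>2)"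
    by (intro mult_left_mono) auto
  ultimately have mB: "18 * ln 2 * (B\<^sup>2 * p) \<le> m\<^sup>2"
    by linarith
  have "6 * (L * e) = 6 * (A * e) + 9 * ln 2 * (B\<^sup>2 * p)"
    using e p by (simp add: L_def \<gamma> field_simps)
  \<comment> \<open>This is the average of \<open>mA\<close> and \<open>mB\<close>.\<close>
  with mA mB have Le: "6 * (L * e) \<le> m\<^sup>2"
    by linarith
  \<comment> \<open>The factor \<open>M\<close> of the distance cancels against the one in the
    iteration count.\<close>
  have "2 * L * n\<^sup>2 / t\<^sup>2 \<le> 2 * L * (M * e)\<^sup>2 / (M * m)\<^sup>2"
    using L n t M \<open>0 < m\<close> by (intro frac_le mult_left_mono power_mono) auto
  also have "\<dots> = 2 * (L * e) * e / m\<^sup>2"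
    using M by (simp add: power_mult_distrib power2_eq_square)
  also have "\<dots> \<le> e / 3"
    using mult_right_mono[OF Le, of e] e \<open>0 < m\<close> by (simp add: field_simps)
  finally have "2 * L * n\<^sup>2 / t\<^sup>2 \<le> e / 3" .
  moreover have "\<gamma> * ln 2 \<le> e / 6"
    using p e by (simp add: \<gamma> field_simps)
  ultimately show ?thesis
    unfolding L_def by linarith
qed


text \<open>Here \<open>c\<close> is a negative constant, so all points are feasible, and
  \<open>f\<close> lies below an affine function while bounded below by its minimum, so it is
  constant. This case is separate because step counts and smoothness parameters may vanish in
  it.\<close>

lemma constant_if_degenerate:
  fixes f c :: "'a::euclidean_space \<Rightarrow> real"
  assumes f: "smooth 0 f" and c: "0-lipschitz_on UNIV c" "\<exists>z. c z < 0" and opt: "opt_set f c \<noteq> {}"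
  shows "f x \<le> opt_val f c"
proof -
  obtain q where q: "q \<in> opt_set f c"
    using opt by blast
  obtain z where "c z < 0"
    using c(2) by blast
  moreover have "c y = c z" for y
    using lipschitz_onD[OF c(1), of y z] by simp
  ultimately have "c y \<le> 0" for y
    by (metis less_imp_le)
  then have min: "f q \<le> f y" for y
    using q by (simp add: opt_set_def feasible_def)
  have aff: "f y \<le> f q + gradient f q \<bullet> (y - q)" for y
    using smooth_descent[OF f, of y q] by simp
  \<comment> \<open>A unit gradient step from the minimizer would otherwise lower
    \<open>f\<close>.\<close>
  have "gradient f q \<bullet> gradient f q \<le> 0"
    using aff[of "q - gradient f q"] min[of "q - gradient f q"] by simp
  then have "gradient f q = 0"
    by (metis inner_gt_zero_iff not_le)
  then show ?thesis
    using aff[of x] opt_val_eq[OF q] by simp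
qed

lemma le_power_nat_ceiling_log:
  assumes "0 < (x::real)"
  shows "x \<le> 2 ^ nat \<lceil>log 2 x\<rceil>"
proof -
  have "x = 2 powr log 2 x"
    using assms by simp
  also have "\<dots> \<le> 2 powr real (nat \<lceil>log 2 x\<rceil>)"
    \<comment> \<open>For \<open>x < 1\<close> the logarithm is negative and \<open>nat\<close>
      truncates to 0, which only raises the exponent.\<close>
    by (intro powr_mono real_nat_ceiling_ge) simp
  finally show ?thesis
    by (simp add: powr_realpow)
qed

theorem theorem5:
  fixes f c :: "real ^ 'd \<Rightarrow> real"
    and G G\<^sub>c L\<^sub>f L\<^sub>c \<rho> lam p \<epsilon> \<epsilon>\<^sub>0 \<theta> \<sigma> \<gamma>\<^sub>1 :: real
    and x\<^sub>0 :: "real ^ 'd"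
    and K :: nat
    and t :: "nat \<Rightarrow> nat"
  assumes "convex_on UNIV f"
    and "convex_on UNIV c" and "lower_semicontinuous c"
    and "\<rho> > 0" and "regularity c \<rho>"
    and "\<exists>x. c x < 0"
    and "G-lipschitz_on UNIV f" and "G\<^sub>c-lipschitz_on UNIV c"
    and "\<epsilon>\<^sub>0 \<ge> 0" and "x\<^sub>0 \<in> feasible c" and "f x\<^sub>0 - opt_val f c \<le> \<epsilon>\<^sub>0"
    and "opt_set f c \<noteq> {}" and "convex (opt_set f c)" and "compact (opt_set f c)"
    and "\<epsilon> > 0" and "0 < \<theta>" and "\<theta> \<le> 1" and "\<sigma> > 0"
    and "local_error_bound f c \<epsilon> \<theta> \<sigma>"
    and "smooth L\<^sub>f f" and "smooth L\<^sub>c c"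
    and "lam > G / \<rho>"
    and "p = lam * \<rho> / (lam * \<rho> - G)"
    and "\<gamma>\<^sub>1 = \<epsilon>\<^sub>0 / (6 * p * ln 2)"
    and "K = nat \<lceil>log 2 (\<epsilon>\<^sub>0 / \<epsilon>)\<rceil>"
    and "\<forall>k \<in> {1..K}. t k =
           nat \<lceil>\<sigma> / \<epsilon> powr (1 - \<theta>) *
                 max (lam * G\<^sub>c * p * sqrt (18 * ln 2))
                     (sqrt (12 * (L\<^sub>f + lam * L\<^sub>c) * \<epsilon>\<^sub>0 / 2 ^ (k - 1)))\<rceil>"
  shows "f (lopnag f c L\<^sub>f L\<^sub>c G\<^sub>c lam t \<gamma>\<^sub>1 x\<^sub>0 K) - opt_val f c \<le> 2 * \<epsilon>"
proof -
  note f = \<open>convex_on UNIV f\<close> \<open>smooth L\<^sub>f f\<close>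
    and c = \<open>convex_on UNIV c\<close> \<open>smooth L\<^sub>c c\<close> \<open>G\<^sub>c-lipschitz_on UNIV c\<close>
  note f_cont = smooth_continuous_on[OF f(2), of UNIV]
    and c_cont = smooth_continuous_on[OF c(2), of UNIV]
  have feas: "closed (feasible c)" "feasible c \<noteq> {}"
    using closed_feasible[OF c_cont] \<open>x\<^sub>0 \<in> feasible c\<close> by auto
  have G: "0 \<le> G" "0 \<le> G\<^sub>c"
    using assms(7,8) by (auto intro: lipschitz_on_nonneg)
  have L0: "0 \<le> L\<^sub>f" "0 \<le> L\<^sub>c"
    using f(2) c(2) by (auto intro: smooth_nonneg)
  have "0 \<le> G / \<rho>"
    using G \<open>0 < \<rho>\<close> by simp
  with \<open>G / \<rho> < lam\<close> have lam: "0 < lam"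
    by linarith
  have lam_G: "G < lam * \<rho>"
    using \<open>G / \<rho> < lam\<close> \<open>0 < \<rho>\<close> by (simp add: pos_divide_less_eq)
  then have p: "1 \<le> p"
    using G by (simp add: \<open>p = _\<close>)
  show ?thesis
  proof (cases "L\<^sub>f = 0 \<and> G\<^sub>c = 0")
    case True
    then have "f (lopnag f c L\<^sub>f L\<^sub>c G\<^sub>c lam t \<gamma>\<^sub>1 x\<^sub>0 K) \<le> opt_val f c"
      using constant_if_degenerate f c assms by metis
    with \<open>0 < \<epsilon>\<close> show ?thesis
      by linarith
  next
    case nondeg: False
    define A B M where "A = L\<^sub>f + lam * L\<^sub>c" and "B = lam * G\<^sub>c" and "M = \<sigma> / \<epsilon> powr (1 - \<theta>)"
    have AB: "0 \<le> A" "0 \<le> B" "0 < A \<or> 0 < B"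
      using L0 G lam nondeg by (auto simp: A_def B_def add_pos_nonneg order.order_iff_strict)
    have M: "0 < M"
      using \<open>0 < \<epsilon>\<close> \<open>0 < \<sigma>\<close> by (simp add: M_def)
    define S where "S = lopnag_state f c L\<^sub>f L\<^sub>c G\<^sub>c lam t \<gamma>\<^sub>1 x\<^sub>0"
    have inv: "fst (S k) \<in> feasible c \<and> snd (S k) = \<gamma>\<^sub>1 / 2 ^ k
        \<and> f (fst (S k)) - opt_val f c \<le> \<epsilon> + \<epsilon>\<^sub>0 / 2 ^ k" if "k \<le> K" for k
      using that
    proof (induction k)
      case 0
      then show ?case
        using assms by (simp add: S_def)
    next
      case (Suc k)
      \<comment> \<open>Epoch \<open>Suc k\<close> starts from the state after \<open>k\<close>
        epochs, so the exponent \<open>k - 1\<close> of its step count becomes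
        \<open>k\<close>.\<close>
      define e \<gamma> x where "e = \<epsilon>\<^sub>0 / 2 ^ k" and "\<gamma> = \<gamma>\<^sub>1 / 2 ^ k" and "x = fst (S k)"
      define L where "L = penalized_smoothness L\<^sub>f L\<^sub>c G\<^sub>c lam \<gamma>"
      define m where "m = max (B * p * sqrt (18 * ln 2)) (sqrt (12 * A * e))"
      define F where "F = penalized f c lam \<gamma>"
      define xhat where "xhat = fst (nag F L x (t (Suc k)))"
      define x' where "x' = closest_point (feasible c) xhat"
      have IH: "x \<in> feasible c" "f x - opt_val f c \<le> \<epsilon> + e" and Sk: "S k = (x, \<gamma>)"
        using Suc by (auto simp: x_def e_def \<gamma>_def prod_eq_iff)
      have S_Suc: "S (Suc k) = (x', \<gamma> / 2)"
        using Sk by (simp add: S_def x'_def xhat_def F_def L_def)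
      \<comment> \<open>If \<open>\<epsilon>\<^sub>0 = 0\<close> then \<open>log 2 0 = 0\<close>, so that no epoch is run.\<close>
      have "\<epsilon>\<^sub>0 \<noteq> 0"
        using Suc.prems by (auto simp: \<open>K = _\<close> log_def)
      then have e: "0 < e"
        using \<open>0 \<le> \<epsilon>\<^sub>0\<close> by (simp add: e_def)
      have \<gamma>: "\<gamma> = e / (6 * p * ln 2)"
        by (simp add: \<gamma>_def e_def \<open>\<gamma>\<^sub>1 = _\<close>)
      then have \<gamma>_pos: "0 < \<gamma>"
        using e p by simp
      have L: "L = A + B\<^sup>2 / (4 * \<gamma>)"
        by (simp add: L_def penalized_smoothness_def A_def B_def power_mult_distrib)
      have L_pos: "0 < L"
        using AB \<gamma>_pos by (auto simp: L add_pos_nonneg add_nonneg_pos)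
      have m: "0 < m"
        using AB e p by (auto simp: m_def less_max_iff_disj)
      have t: "t (Suc k) = nat \<lceil>M * m\<rceil>"
        using assms(26) Suc.prems by (simp add: M_def m_def A_def B_def e_def)
      \<comment> \<open>At least one inner step is taken, as \<open>nag_rate\<close>
        requires.\<close>
      obtain s where s: "t (Suc k) = Suc s"
        using t M m by (metis mult_pos_pos not0_implies_Suc not_le of_nat_0 real_nat_ceiling_ge)
      obtain u where u: "u \<in> sublevel f c \<epsilon>" "norm (x - u) \<le> M * e"
        using dist_sublevel[OF f(1) f_cont c(1) c_cont \<open>opt_set f c \<noteq> {}\<close>
            compact_imp_closed[OF \<open>compact (opt_set f c)\<close>] \<open>local_error_bound f c \<epsilon> \<theta> \<sigma>\<close>
            \<open>0 < \<epsilon>\<close> \<open>0 < \<theta>\<close> \<open>0 < \<sigma>\<close> IH] e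
        unfolding M_def by auto
      have "F xhat - F u \<le> 2 * L * (norm (x - u))\<^sup>2 / (real (t (Suc k)))\<^sup>2"
        unfolding xhat_def s F_def
      proof (rule nag_rate[where D = "penalized_gradient f c lam \<gamma>"])
        note hyps = f(2,1) c(2,1,3) \<gamma>_pos less_imp_le[OF lam]
        show "GDERIV (penalized f c lam \<gamma>) y :> penalized_gradient f c lam \<gamma> y" for y
          by (rule penalized_GDERIV[OF hyps])
        show "penalized f c lam \<gamma> y + penalized_gradient f c lam \<gamma> y \<bullet> (v - y)
            \<le> penalized f c lam \<gamma> v" for y v
          by (rule penalized_tangent[OF hyps])
        show "penalized f c lam \<gamma> v \<le> penalized f c lam \<gamma> y
            + penalized_gradient f c lam \<gamma> y \<bullet> (v - y) + L / 2 * (norm (v - y))\<^sup>2" for v y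
          unfolding L_def by (rule penalized_descent[OF hyps])
      qed (rule L_pos)
      moreover have "f x' - f u \<le> \<gamma> * ln 2 + (F xhat - F u)"
        unfolding x'_def F_def
      proof (rule penalty_projection[OF \<gamma>_pos _ \<open>G-lipschitz_on UNIV f\<close>])
        show "\<rho> * norm (xhat - closest_point (feasible c) xhat) \<le> max (c xhat) 0"
          using regularity_error_bound c assms by blast
      qed (use lam lam_G u(1) in \<open>auto simp: sublevel_def\<close>)
      moreover have "\<gamma> * ln 2 + 2 * L * (norm (x - u))\<^sup>2 / (real (t (Suc k)))\<^sup>2 \<le> e / 2"
        unfolding L by (rule epoch_error[OF p e AB(1) \<gamma> m_def AB(2) m _ M])
          (auto simp: t u(2) real_nat_ceiling_ge)
      ultimately have "f x' - f u \<le> e / 2"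
        by linarith
      \<comment> \<open>The excess \<open>\<epsilon>\<close> of \<open>u\<close> does not
        accumulate: every epoch measures it afresh from the optimal value, and only \<open>e\<close>
        is halved.\<close>
      moreover have "f u \<le> opt_val f c + \<epsilon>"
        using u(1) by (simp add: sublevel_def)
      ultimately have "f x' - opt_val f c \<le> \<epsilon> + e / 2"
        by linarith
      moreover have "x' \<in> feasible c"
        unfolding x'_def by (rule closest_point_in_set[OF feas])
      ultimately show ?case
        by (simp add: S_Suc e_def \<gamma>_def mult.commute)
    qed
    \<comment> \<open>The number of epochs makes the second summand of the invariant at most
      \<open>\<epsilon>\<close>, whence the total \<open>2 * \<epsilon>\<close>.\<close>
    have "\<epsilon>\<^sub>0 / 2 ^ K \<le> \<epsilon>"
    proof (cases "\<epsilon>\<^sub>0 = 0")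
      case False
      then have "\<epsilon>\<^sub>0 / \<epsilon> \<le> 2 ^ K"
        using le_power_nat_ceiling_log[of "\<epsilon>\<^sub>0 / \<epsilon>"] assms by simp
      then show ?thesis
        using \<open>0 < \<epsilon>\<close> by (simp add: field_simps)
    qed (use \<open>0 < \<epsilon>\<close> in simp)
    then show ?thesis
      using inv[of K] by (simp add: lopnag_def S_def)
  qed
qed

end
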